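(* There exists a finitely presented soluble group $G$ which is not LERF but which does not contain a strictly ascending HNN extension of a finitely generated abelian group (that is, no subgroup of $G$ is a strictly ascending HNN extension whose base is a finitely generated abelian group).
   Context: A group is LERF (locally extended residually finite) if every finitely generated subgroup is an intersection of finite index subgroups. Given a group $B$ and an isomorphism $\theta$ from $B$ onto a subgroup $A$ of $B$, the ascending HNN extension $\langle t,B\rangle$ with base $B$ and stable letter $t$ is the group obtained from the free product $B*\langle t\rangle$ (with $t$ of infinite order) by adding the relations $tbt^{-1}=\theta(b)$ for all $b\in B$. It is strictly ascending if $A\neq B$, i.e. if $tBt^{-1}$ is a proper subgroup of $B$. A subgroup $H$ of a group $G$ is said to be a strictly ascending HNN extension with base $B$ and stable letter $t$ if $B\leq H$, $t\in H$, $H$ is generated by $t$ and $B$, $tBt^{-1}\subsetneq B$, and the natural map from the abstract ascending HNN extension of $B$ defined by $b\mapsto tbt^{-1}$ to $H$ is an isomorphism. A group "contains a strictly ascending HNN extension of a group of a certain type" if it has a subgroup that is a strictly ascending HNN extension whose base is of that type. *)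

theory Defs
  imports "HOL-Algebra.Solvable_Groups" "HOL-Algebra.Elementary_Groups"
begin

section \<open>Words modulo a set of rewrite rules\<close>

inductive word_cong :: "'s set \<Rightarrow> ('s list \<times> 's list) set \<Rightarrow> 's list \<Rightarrow> 's list \<Rightarrow> bool"
  for A R where
    rule: "\<lbrakk>(l, r) \<in> R; l \<in> lists A; r \<in> lists A; u \<in> lists A; v \<in> lists A\<rbrakk>
             \<Longrightarrow> word_cong A R (u @ l @ v) (u @ r @ v)"
  | refl: "w \<in> lists A \<Longrightarrow> word_cong A R w w"
  | sym: "word_cong A R v w \<Longrightarrow> word_cong A R w v"
  | trans: "\<lbrakk>word_cong A R u v; word_cong A R v w\<rbrakk> \<Longrightarrow> word_cong A R u w"

definition word_class :: "'s set \<Rightarrow> ('s list \<times> 's list) set \<Rightarrow> 's list \<Rightarrow> 's list set"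
  where "word_class A R w = {v. word_cong A R w v}"

definition word_monoid :: "'s set \<Rightarrow> ('s list \<times> 's list) set \<Rightarrow> 's list set monoid"
  where "word_monoid A R =
    \<lparr>carrier = word_class A R ` lists A,
     monoid.mult = (\<lambda>C D. \<Union>u\<in>C. \<Union>v\<in>D. word_class A R (u @ v)),
     one = word_class A R []\<rparr>"

lemma word_cong_in_lists:
  assumes "word_cong A R u v" shows "u \<in> lists A \<and> v \<in> lists A"
  using assms by induction auto

lemma word_cong_append_left:
  assumes "word_cong A R u v" "w \<in> lists A" shows "word_cong A R (w @ u) (w @ v)"
  using assms
proof (induction)
  case (rule l r u v)
  then have "word_cong A R ((w @ u) @ l @ v) ((w @ u) @ r @ v)"
    by (intro word_cong.rule) auto
  then show ?case by simp
next
  case (refl u)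
  then show ?case by (intro word_cong.refl) auto
next
  case (sym u v)
  then show ?case by (blast intro: word_cong.sym)
next
  case (trans u v w')
  then show ?case by (blast intro: word_cong.trans)
qed

lemma word_cong_append_right:
  assumes "word_cong A R u v" "w \<in> lists A" shows "word_cong A R (u @ w) (v @ w)"
  using assms
proof (induction)
  case (rule l r u v)
  then have "word_cong A R (u @ l @ (v @ w)) (u @ r @ (v @ w))"
    by (intro word_cong.rule) auto
  then show ?case by simp
next
  case (refl u)
  then show ?case by (intro word_cong.refl) auto
next
  case (sym u v)
  then show ?case by (blast intro: word_cong.sym)
next
  case (trans u v w')
  then show ?case by (blast intro: word_cong.trans)
qed

lemma word_cong_append:
  assumes "word_cong A R u v" "word_cong A R u' v'" shows "word_cong A R (u @ u') (v @ v')"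
proof (rule word_cong.trans)
  show "word_cong A R (u @ u') (v @ u')"
    using assms word_cong_in_lists[OF assms(2)] by (simp add: word_cong_append_right)
  show "word_cong A R (v @ u') (v @ v')"
    using assms word_cong_in_lists[OF assms(1)] by (simp add: word_cong_append_left)
qed

lemma word_class_eq_iff:
  assumes "u \<in> lists A" shows "word_class A R u = word_class A R v \<longleftrightarrow> word_cong A R u v"
proof
  assume "word_class A R u = word_class A R v"
  moreover have "u \<in> word_class A R u"
    using assms by (simp add: word_class_def word_cong.refl)
  ultimately have "word_cong A R v u"
    by (simp add: word_class_def)
  then show "word_cong A R u v" by (rule word_cong.sym)
next
  assume uv: "word_cong A R u v"
  then have vu: "word_cong A R v u" by (rule word_cong.sym)
  show "word_class A R u = word_class A R v"
    unfolding word_class_def using word_cong.trans[OF uv] word_cong.trans[OF vu] by blast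
qed

lemma word_monoid_mult:
  assumes "u \<in> lists A" "v \<in> lists A"
  shows "word_class A R u \<otimes>\<^bsub>word_monoid A R\<^esub> word_class A R v = word_class A R (u @ v)"
proof -
  have "word_class A R (u' @ v') = word_class A R (u @ v)"
    if "u' \<in> word_class A R u" "v' \<in> word_class A R v" for u' v'
  proof -
    have "word_cong A R (u @ v) (u' @ v')"
      using that by (simp add: word_class_def word_cong_append)
    then have "word_class A R (u @ v) = word_class A R (u' @ v')"
      using assms by (subst word_class_eq_iff) auto
    then show ?thesis by (rule HOL.sym)
  qed
  moreover have "u \<in> word_class A R u" "v \<in> word_class A R v"
    using assms by (simp_all add: word_class_def word_cong.refl)
  ultimately have "(\<Union>u'\<in>word_class A R u. \<Union>v'\<in>word_class A R v. word_class A R (u' @ v'))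
      = word_class A R (u @ v)"
    by blast
  then show ?thesis by (simp add: word_monoid_def)
qed

lemma word_monoid_simps:
  "carrier (word_monoid A R) = word_class A R ` lists A"
  "\<one>\<^bsub>word_monoid A R\<^esub> = word_class A R []"
  by (simp_all add: word_monoid_def)

lemma group_word_monoid:
  assumes inv: "\<And>a. a \<in> A \<Longrightarrow> \<exists>b\<in>A. word_cong A R [b, a] []"
  shows "group (word_monoid A R)"
proof (rule groupI)
  fix x assume "x \<in> carrier (word_monoid A R)"
  then obtain w where w: "w \<in> lists A" "x = word_class A R w"
    by (auto simp: word_monoid_simps)
  have "\<exists>v\<in>lists A. word_cong A R (v @ w) []"
    using w(1)
  proof (induction w)
    case Nil
    then show ?case by (auto intro: bexI[of _ "[]"] word_cong.refl)
  next
    case (Cons a w)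
    obtain v where v: "v \<in> lists A" "word_cong A R (v @ w) []"
      using Cons by auto
    obtain b where b: "b \<in> A" "word_cong A R [b, a] []"
      using inv[of a] Cons by blast
    have "word_cong A R (v @ ([b, a] @ w)) (v @ ([] @ w))"
      using v b Cons by (intro word_cong_append_left word_cong_append_right) auto
    from word_cong.trans[OF this] v(2) have "word_cong A R ((v @ [b]) @ a # w) []"
      by simp
    then show ?case using v b by (intro bexI[of _ "v @ [b]"]) auto
  qed
  then obtain v where "v \<in> lists A" "word_cong A R (v @ w) []" by blast
  with w show "\<exists>y\<in>carrier (word_monoid A R). y \<otimes>\<^bsub>word_monoid A R\<^esub> x = \<one>\<^bsub>word_monoid A R\<^esub>"
    by (intro bexI[of _ "word_class A R v"])
       (auto simp: word_monoid_simps word_monoid_mult word_class_eq_iff)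
next
  fix x y assume "x \<in> carrier (word_monoid A R)" "y \<in> carrier (word_monoid A R)"
  then obtain u v where "u \<in> lists A" "x = word_class A R u" "v \<in> lists A" "y = word_class A R v"
    unfolding word_monoid_simps by blast
  then show "x \<otimes>\<^bsub>word_monoid A R\<^esub> y \<in> carrier (word_monoid A R)"
    by (metis word_monoid_mult word_monoid_simps(1) append_in_lists_conv imageI)
next
  fix x y z
  assume "x \<in> carrier (word_monoid A R)" "y \<in> carrier (word_monoid A R)"
    "z \<in> carrier (word_monoid A R)"
  then obtain u v w where "u \<in> lists A" "x = word_class A R u" "v \<in> lists A" "y = word_class A R v"
    "w \<in> lists A" "z = word_class A R w"
    unfolding word_monoid_simps by blast
  then show "x \<otimes>\<^bsub>word_monoid A R\<^esub> y \<otimes>\<^bsub>word_monoid A R\<^esub> z =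
      x \<otimes>\<^bsub>word_monoid A R\<^esub> (y \<otimes>\<^bsub>word_monoid A R\<^esub> z)"
    by (metis word_monoid_mult append_in_lists_conv append_assoc)
qed (auto simp: word_monoid_simps word_monoid_mult[unfolded in_lists_conv_set])


section \<open>Free groups, free products and finite presentations\<close>

text \<open>The letters \<open>(True, x)\<close> and \<open>(False, x)\<close> stand for the generator \<open>x\<close> and its inverse.\<close>

definition free_group :: "'x set \<Rightarrow> (bool \<times> 'x) list set monoid"
  where "free_group X =
    word_monoid (UNIV \<times> X) {([(b, x), (\<not> b, x)], []) | b x. x \<in> X}"

text \<open>The alphabet is the disjoint union of the two carriers; a word is identified with another
  one if it arises by multiplying adjacent letters of the same factor or by deleting the unit of
  a factor.\<close>

definition free_product_rules ::
    "('a, 'c) monoid_scheme \<Rightarrow> ('b, 'd) monoid_scheme \<Rightarrow> (('a + 'b) list \<times> ('a + 'b) list) set"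
  where "free_product_rules G H =
      {([Inl x, Inl y], [Inl (x \<otimes>\<^bsub>G\<^esub> y)]) | x y. x \<in> carrier G \<and> y \<in> carrier G}
    \<union> {([Inr x, Inr y], [Inr (x \<otimes>\<^bsub>H\<^esub> y)]) | x y. x \<in> carrier H \<and> y \<in> carrier H}
    \<union> {([Inl \<one>\<^bsub>G\<^esub>], []), ([Inr \<one>\<^bsub>H\<^esub>], [])}"

definition free_product ::
    "('a, 'c) monoid_scheme \<Rightarrow> ('b, 'd) monoid_scheme \<Rightarrow> ('a + 'b) list set monoid"
  where "free_product G H = word_monoid (carrier G <+> carrier H) (free_product_rules G H)"

definition free_product_inl ::
    "('a, 'c) monoid_scheme \<Rightarrow> ('b, 'd) monoid_scheme \<Rightarrow> 'a \<Rightarrow> ('a + 'b) list set"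
  where "free_product_inl G H x =
    word_class (carrier G <+> carrier H) (free_product_rules G H) [Inl x]"

definition free_product_inr ::
    "('a, 'c) monoid_scheme \<Rightarrow> ('b, 'd) monoid_scheme \<Rightarrow> 'b \<Rightarrow> ('a + 'b) list set"
  where "free_product_inr G H y =
    word_class (carrier G <+> carrier H) (free_product_rules G H) [Inr y]"

definition normal_closure :: "('a, 'c) monoid_scheme \<Rightarrow> 'a set \<Rightarrow> 'a set"
  where "normal_closure G R = \<Inter>{N. N \<lhd> G \<and> R \<subseteq> N}"

definition finitely_presented :: "('a, 'c) monoid_scheme \<Rightarrow> bool"
  where "finitely_presented G \<longleftrightarrow>
    (\<exists>(X :: nat set) R. finite X \<and> finite R \<and> R \<subseteq> carrier (free_group X) \<and>
       free_group X Mod normal_closure (free_group X) R \<cong> G)"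

lemma (in group) normal_closure_normal:
  assumes "R \<subseteq> carrier G" shows "normal_closure G R \<lhd> G"
proof -
  have ne: "carrier G \<in> {N. N \<lhd> G \<and> R \<subseteq> N}"
    using assms normal_self by simp
  have "subgroup (normal_closure G R) G"
    unfolding normal_closure_def using ne by (intro subgroups_Inter) (auto simp: normal_def)
  moreover have "x \<otimes> h \<otimes> inv x \<in> normal_closure G R"
    if "x \<in> carrier G" "h \<in> normal_closure G R" for x h
    using that by (auto simp: normal_closure_def normal.inv_op_closed2)
  ultimately show ?thesis by (simp add: normal_inv_iff)
qed

lemma group_free_group: "group (free_group X)"
  unfolding free_group_def
proof (rule group_word_monoid)
  fix a :: "bool \<times> 'a" assume a: "a \<in> UNIV \<times> X"
  obtain b x where [simp]: "a = (b, x)" by fastforce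
  let ?A = "(UNIV :: bool set) \<times> X"
  let ?R = "{([(b, x), (\<not> b, x)], []) | b x. x \<in> X}"
  have "word_cong ?A ?R ([] @ [(\<not> b, x), (b, x)] @ []) ([] @ [] @ [])"
    using a by (intro word_cong.rule) auto
  then show "\<exists>c\<in>?A. word_cong ?A ?R [c, a] []"
    using a by (intro bexI[of _ "(\<not> b, x)"]) auto
qed

lemma group_free_product:
  assumes "group G" "group H" shows "group (free_product G H)"
  unfolding free_product_def
proof (rule group_word_monoid)
  interpret G: group G by fact
  interpret H: group H by fact
  let ?A = "carrier G <+> carrier H"
  let ?R = "free_product_rules G H"
  have step: "word_cong ?A ?R l r"
    if "(l, r) \<in> ?R" "l \<in> lists ?A" "r \<in> lists ?A" for l r
    using word_cong.rule[OF that, of "[]" "[]"] by simp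
  fix a assume a: "a \<in> ?A"
  then show "\<exists>b\<in>?A. word_cong ?A ?R [b, a] []"
  proof
    fix x assume x: "a = Inl x" "x \<in> carrier G"
    have "([Inl (inv\<^bsub>G\<^esub> x), Inl x], [Inl (inv\<^bsub>G\<^esub> x \<otimes>\<^bsub>G\<^esub> x)]) \<in> ?R"
      using x by (auto simp: free_product_rules_def)
    then have 1: "word_cong ?A ?R [Inl (inv\<^bsub>G\<^esub> x), Inl x] [Inl \<one>\<^bsub>G\<^esub>]"
      using x by (intro step) auto
    have 2: "word_cong ?A ?R [Inl \<one>\<^bsub>G\<^esub>] []"
      by (intro step) (auto simp: free_product_rules_def)
    show ?thesis
      using word_cong.trans[OF 1 2] x by (intro bexI[of _ "Inl (inv\<^bsub>G\<^esub> x)"]) auto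
  next
    fix x assume x: "a = Inr x" "x \<in> carrier H"
    have "([Inr (inv\<^bsub>H\<^esub> x), Inr x], [Inr (inv\<^bsub>H\<^esub> x \<otimes>\<^bsub>H\<^esub> x)]) \<in> ?R"
      using x by (auto simp: free_product_rules_def)
    then have 1: "word_cong ?A ?R [Inr (inv\<^bsub>H\<^esub> x), Inr x] [Inr \<one>\<^bsub>H\<^esub>]"
      using x by (intro step) auto
    have 2: "word_cong ?A ?R [Inr \<one>\<^bsub>H\<^esub>] []"
      by (intro step) (auto simp: free_product_rules_def)
    show ?thesis
      using word_cong.trans[OF 1 2] x by (intro bexI[of _ "Inr (inv\<^bsub>H\<^esub> x)"]) auto
  qed
qed


section \<open>Subgroup separability\<close>

definition fg_subgroup :: "'a set \<Rightarrow> ('a, 'c) monoid_scheme \<Rightarrow> bool"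
  where "fg_subgroup H G \<longleftrightarrow> (\<exists>S. finite S \<and> S \<subseteq> carrier G \<and> H = generate G S)"

text \<open>The family \<open>F\<close> is required to be nonempty because \<open>\<Inter>{}\<close> is \<open>UNIV\<close> and not
  \<open>carrier G\<close>.\<close>

definition LERF :: "('a, 'c) monoid_scheme \<Rightarrow> bool"
  where "LERF G \<longleftrightarrow>
    (\<forall>H. fg_subgroup H G \<longrightarrow>
      (\<exists>F. F \<noteq> {} \<and> (\<forall>K\<in>F. subgroup K G \<and> finite (rcosets\<^bsub>G\<^esub> K)) \<and> H = \<Inter>F))"


section \<open>Ascending HNN extensions\<close>

text \<open>For a group \<open>B\<close> and an injective endomorphism \<open>\<theta>\<close> of \<open>B\<close>; the infinite cyclic factor
  \<open>\<langle>t\<rangle>\<close> is \<open>integer_group\<close>, with \<open>t\<close> its element \<open>1\<close>.\<close>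

definition HNN_relators :: "('a, 'c) monoid_scheme \<Rightarrow> ('a \<Rightarrow> 'a) \<Rightarrow> ('a + int) list set set"
  where "HNN_relators B \<theta> =
    (let P = free_product B integer_group;
         i = free_product_inl B integer_group;
         t = free_product_inr B integer_group 1
     in {t \<otimes>\<^bsub>P\<^esub> i b \<otimes>\<^bsub>P\<^esub> inv\<^bsub>P\<^esub> t \<otimes>\<^bsub>P\<^esub> inv\<^bsub>P\<^esub> (i (\<theta> b)) | b. b \<in> carrier B})"

definition HNN_kernel :: "('a, 'c) monoid_scheme \<Rightarrow> ('a \<Rightarrow> 'a) \<Rightarrow> ('a + int) list set set"
  where "HNN_kernel B \<theta> = normal_closure (free_product B integer_group) (HNN_relators B \<theta>)"

definition ascending_HNN ::
    "('a, 'c) monoid_scheme \<Rightarrow> ('a \<Rightarrow> 'a) \<Rightarrow> ('a + int) list set set monoid"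
  where "ascending_HNN B \<theta> = free_product B integer_group Mod HNN_kernel B \<theta>"

definition HNN_base ::
    "('a, 'c) monoid_scheme \<Rightarrow> ('a \<Rightarrow> 'a) \<Rightarrow> 'a \<Rightarrow> ('a + int) list set set"
  where "HNN_base B \<theta> b =
    HNN_kernel B \<theta> #>\<^bsub>free_product B integer_group\<^esub> free_product_inl B integer_group b"

definition HNN_stable :: "('a, 'c) monoid_scheme \<Rightarrow> ('a \<Rightarrow> 'a) \<Rightarrow> ('a + int) list set set"
  where "HNN_stable B \<theta> =
    HNN_kernel B \<theta> #>\<^bsub>free_product B integer_group\<^esub> free_product_inr B integer_group 1"

text \<open>The natural map is the homomorphism that sends the image of each \<open>b \<in> B\<close> in the abstract
  extension to \<open>b\<close> and the abstract stable letter to \<open>t\<close>; these conditions determine it, since the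
  abstract extension is generated by those elements.\<close>

definition strictly_ascending_HNN_in ::
    "('a, 'c) monoid_scheme \<Rightarrow> 'a set \<Rightarrow> 'a set \<Rightarrow> 'a \<Rightarrow> bool"
  where "strictly_ascending_HNN_in G H B t \<longleftrightarrow>
    subgroup H G \<and> subgroup B G \<and> B \<subseteq> H \<and> t \<in> H \<and> H = generate G (insert t B) \<and>
    (let \<theta> = (\<lambda>b. t \<otimes>\<^bsub>G\<^esub> b \<otimes>\<^bsub>G\<^esub> inv\<^bsub>G\<^esub> t); B' = G\<lparr>carrier := B\<rparr>
     in \<theta> ` B \<subset> B \<and>
        (\<exists>\<phi> \<in> iso (ascending_HNN B' \<theta>) (G\<lparr>carrier := H\<rparr>).
           (\<forall>b\<in>B. \<phi> (HNN_base B' \<theta> b) = b) \<and> \<phi> (HNN_stable B' \<theta>) = t))"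

end

theory Submission
  imports Defs "HOL-Algebra.FiniteProduct" "HOL-Algebra.Weak_Morphisms" "HOL-Algebra.Bij"
    "HOL-Library.Z2" "HOL-Library.Countable_Set"
    "HOL-Computational_Algebra.Formal_Laurent_Series"
begin

text \<open>Take Baumslag's group \<open>G = \<langle>a, s, t | a\<^sup>2, [s, t], [a, sas\<^sup>-\<^sup>1], tat\<^sup>-\<^sup>1 = a \<cdot> sas\<^sup>-\<^sup>1\<rangle>\<close>, that is,
  \<open>GF(2)[X, X\<^sup>-\<^sup>1, (1 + X)\<^sup>-\<^sup>1] \<rtimes> \<int>\<^sup>2\<close> with \<open>s\<close> and \<open>t\<close> acting as multiplication by \<open>X\<close> and \<open>1 + X\<close>.
  The relations force all conjugates of \<open>a\<close> to commute, so \<open>G\<close> is an extension of an elementary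
  abelian 2-group by an abelian group. Conjugation by any element therefore fixes the squares of an
  abelian subgroup \<open>B\<close> that it maps into itself, and as \<open>B\<close> modulo squares is finite for finitely
  generated \<open>B\<close>, it maps \<open>B\<close> onto itself. On the other hand conjugation by \<open>t\<close> maps the
  (nonabelian) lamplighter group \<open>\<langle>a, s\<rangle>\<close> properly into itself, which no subgroup separable group
  allows. That \<open>t\<^sup>-\<^sup>1at\<close> lies outside \<open>\<langle>a, s\<rangle>\<close> is seen in the affine action on \<open>GF(2)((X))\<close>:
  \<open>\<langle>a, s\<rangle>\<close> preserves the Laurent polynomials but \<open>t\<^sup>-\<^sup>1at\<close> maps \<open>0\<close> to \<open>(1 + X)\<^sup>-\<^sup>1\<close>.\<close>

section \<open>Conjugation, commuting generators and subgroups of finite index\<close>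

context group
begin

definition conj_by :: "'a \<Rightarrow> 'a \<Rightarrow> 'a"
  where "conj_by g x = g \<otimes> x \<otimes> inv g"

lemma conj_by_closed [simp]:
  "g \<in> carrier G \<Longrightarrow> x \<in> carrier G \<Longrightarrow> conj_by g x \<in> carrier G"
  by (simp add: conj_by_def)

lemma conj_by_one [simp]: "x \<in> carrier G \<Longrightarrow> conj_by \<one> x = x"
  by (simp add: conj_by_def)

lemma inv_mult_cancel_left [simp]:
  assumes "g \<in> carrier G" "x \<in> carrier G"
  shows "inv g \<otimes> (g \<otimes> x) = x" and "g \<otimes> (inv g \<otimes> x) = x"
  using assms by (simp_all flip: m_assoc)

lemma conj_by_mult:
  assumes "g \<in> carrier G" "x \<in> carrier G" "y \<in> carrier G"
  shows "conj_by g (x \<otimes> y) = conj_by g x \<otimes> conj_by g y"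
  using assms by (simp add: conj_by_def m_assoc)

lemma conj_by_conj_by:
  "\<lbrakk>g \<in> carrier G; h \<in> carrier G; x \<in> carrier G\<rbrakk> \<Longrightarrow> conj_by g (conj_by h x) = conj_by (g \<otimes> h) x"
  by (simp add: conj_by_def m_assoc inv_mult_group)

lemma conj_by_inj:
  assumes "g \<in> carrier G" "x \<in> carrier G" "y \<in> carrier G"
  shows "conj_by g x = conj_by g y \<longleftrightarrow> x = y"
  using assms by (simp add: conj_by_def)

lemma conj_by_eq_self_iff:
  assumes "g \<in> carrier G" "x \<in> carrier G"
  shows "conj_by g x = x \<longleftrightarrow> g \<otimes> x = x \<otimes> g"
  using assms inv_solve_right'[of x "g \<otimes> x" g] by (auto simp: conj_by_def)

lemma conj_by_commute_iff:
  assumes "g \<in> carrier G" "x \<in> carrier G" "y \<in> carrier G"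
  shows "conj_by g x \<otimes> conj_by g y = conj_by g y \<otimes> conj_by g x \<longleftrightarrow> x \<otimes> y = y \<otimes> x"
  using assms by (simp add: conj_by_inj flip: conj_by_mult)

lemma conj_by_nat_pow:
  "\<lbrakk>g \<in> carrier G; x \<in> carrier G\<rbrakk> \<Longrightarrow> conj_by (g [^] n) x = (conj_by g ^^ n) x" for n :: nat
proof (induction n)
  case (Suc n)
  have "g [^] Suc n = g \<otimes> g [^] n" using Suc.prems by (intro nat_pow_Suc2)
  with Suc show ?case by (simp flip: conj_by_conj_by del: nat_pow_Suc)
qed simp

lemma subgroup_centralizer:
  assumes "S \<subseteq> carrier G"
  shows "subgroup {x \<in> carrier G. \<forall>y\<in>S. x \<otimes> y = y \<otimes> x} G"
proof (rule subgroupI)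
  fix x assume x: "x \<in> {x \<in> carrier G. \<forall>y\<in>S. x \<otimes> y = y \<otimes> x}"
  have "inv x \<otimes> y = y \<otimes> inv x" if "y \<in> S" for y
  proof -
    have y: "y \<in> carrier G" "x \<otimes> y = y \<otimes> x" using that x assms by auto
    have "inv x \<otimes> y = inv x \<otimes> (y \<otimes> x) \<otimes> inv x" using x y(1) by (simp add: m_assoc)
    also have "\<dots> = (inv x \<otimes> x) \<otimes> y \<otimes> inv x"
      using x y by (metis (no_types, lifting) inv_closed m_assoc mem_Collect_eq)
    finally show ?thesis using x y(1) by simp
  qed
  then show "inv x \<in> {x \<in> carrier G. \<forall>y\<in>S. x \<otimes> y = y \<otimes> x}"
    using x by auto
next
  fix x z
  assume x: "x \<in> {x \<in> carrier G. \<forall>y\<in>S. x \<otimes> y = y \<otimes> x}"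
    and z: "z \<in> {x \<in> carrier G. \<forall>y\<in>S. x \<otimes> y = y \<otimes> x}"
  have "x \<otimes> z \<otimes> y = y \<otimes> (x \<otimes> z)" if "y \<in> S" for y
  proof -
    have y: "y \<in> carrier G" "x \<otimes> y = y \<otimes> x" "z \<otimes> y = y \<otimes> z" using that x z assms by auto
    have "x \<otimes> z \<otimes> y = x \<otimes> y \<otimes> z" using x z y(1) by (simp add: m_assoc y(3))
    then show ?thesis using x z y(1) by (simp add: m_assoc y(2))
  qed
  then show "x \<otimes> z \<in> {x \<in> carrier G. \<forall>y\<in>S. x \<otimes> y = y \<otimes> x}"
    using x z by auto
qed (use assms in \<open>auto intro!: exI[of _ "\<one>"]\<close>)

text \<open>The centralizer argument runs twice: the centralizer of \<open>S\<close> contains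
  \<open>S\<close>, hence \<open>generate G S\<close>; so the centralizer of
  \<open>generate G S\<close> contains \<open>S\<close>, hence again
  \<open>generate G S\<close>.\<close>

lemma generate_commute:
  assumes S: "S \<subseteq> carrier G" and comm: "\<And>x y. \<lbrakk>x \<in> S; y \<in> S\<rbrakk> \<Longrightarrow> x \<otimes> y = y \<otimes> x"
    and x: "x \<in> generate G S" and y: "y \<in> generate G S"
  shows "x \<otimes> y = y \<otimes> x"
proof -
  have "generate G S \<subseteq> {x \<in> carrier G. \<forall>y\<in>S. x \<otimes> y = y \<otimes> x}"
    using S comm by (intro generate_subgroup_incl[OF _ subgroup_centralizer]) auto
  then have "generate G S \<subseteq> {x \<in> carrier G. \<forall>y\<in>generate G S. x \<otimes> y = y \<otimes> x}"
    using S generate_incl[OF S] by (intro generate_subgroup_incl[OF _ subgroup_centralizer]) (auto simp: subset_eq)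
  then show ?thesis using x y by auto
qed

lemma int_pow_commute:
  assumes "x \<in> carrier G" "y \<in> carrier G" "x \<otimes> y = y \<otimes> x"
  shows "x [^] (i::int) \<otimes> y [^] (j::int) = y [^] j \<otimes> x [^] i"
proof (rule generate_commute[of "{x, y}"])
  show "x [^] i \<in> generate G {x, y}" "y [^] j \<in> generate G {x, y}"
    using assms subgroup_int_pow_closed[OF generate_is_subgroup[of "{x, y}"]]
    by (auto intro: generate.incl)
qed (use assms in auto)

lemma generate_square_one:
  assumes S: "S \<subseteq> carrier G" and comm: "\<And>x y. \<lbrakk>x \<in> S; y \<in> S\<rbrakk> \<Longrightarrow> x \<otimes> y = y \<otimes> x"
    and sq: "\<And>x. x \<in> S \<Longrightarrow> x \<otimes> x = \<one>"
    and x: "x \<in> generate G S"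
  shows "x \<otimes> x = \<one>"
  using x
proof induction
  case (inv x)
  then show ?case using sq[of x] S by (metis inv_mult_group inv_one subsetD)
next
  case (eng x y)
  then have xy: "x \<in> carrier G" "y \<in> carrier G" "x \<otimes> y = y \<otimes> x"
    using generate_in_carrier[OF S] generate_commute[OF S comm] by auto
  then have "x \<otimes> y \<otimes> (x \<otimes> y) = (x \<otimes> x) \<otimes> (y \<otimes> y)"
    by (metis m_assoc m_closed)
  with eng show ?case by simp
qed (use sq in auto)

text \<open>The images of \<open>S\<close> generate \<open>G Mod N\<close> and commute there, so the
  quotient is abelian and every commutator falls into \<open>N\<close>.\<close>

lemma derived_subset_normal:
  assumes "N \<lhd> G" and gen: "carrier G = generate G S" and S: "S \<subseteq> carrier G"
    and comm: "\<And>x y. \<lbrakk>x \<in> S; y \<in> S\<rbrakk> \<Longrightarrow> N #> (x \<otimes> y) = N #> (y \<otimes> x)"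
  shows "derived G (carrier G) \<subseteq> N"
proof -
  interpret N: normal N G by fact
  interpret Q: group "G Mod N" by (rule N.factorgroup_is_group)
  interpret h: group_hom G "G Mod N" "(#>) N"
    using N.r_coset_hom_Mod by unfold_locales
  have "x \<otimes> y \<otimes> inv x \<otimes> inv y \<in> N" if xy: "x \<in> carrier G" "y \<in> carrier G" for x y
  proof -
    have im: "carrier (G Mod N) = generate (G Mod N) ((#>) N ` S)"
      using h.generate_img[OF S] gen by (simp add: carrier_FactGroup)
    have "(N #> x) \<otimes>\<^bsub>G Mod N\<^esub> (N #> y) = (N #> y) \<otimes>\<^bsub>G Mod N\<^esub> (N #> x)"
    proof (rule Q.generate_commute[of "(#>) N ` S"])
      show "(#>) N ` S \<subseteq> carrier (G Mod N)" using S by auto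
      show "u \<otimes>\<^bsub>G Mod N\<^esub> v = v \<otimes>\<^bsub>G Mod N\<^esub> u" if "u \<in> (#>) N ` S" "v \<in> (#>) N ` S" for u v
        using that comm S by (auto simp: subset_eq simp flip: h.hom_mult simp del: mult_FactGroup)
    qed (use xy in \<open>simp_all flip: im\<close>)
    then have "N #> (x \<otimes> y) = N #> (y \<otimes> x)"
      using xy by (simp flip: h.hom_mult del: mult_FactGroup)
    then have "(x \<otimes> y) \<otimes> inv (y \<otimes> x) \<in> N"
      using rcos_self[OF _ N.is_subgroup, of "x \<otimes> y"] xy
        N.rcos_module[OF is_group, of "y \<otimes> x" "x \<otimes> y"] by simp
    then show ?thesis using xy by (simp add: inv_mult_group m_assoc)
  qed
  then have "derived_set G (carrier G) \<subseteq> N" by auto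
  then show ?thesis
    unfolding derived_def using N.is_subgroup by (rule generate_subgroup_incl)
qed

text \<open>Pigeonhole: two powers of \<open>x\<close> share a coset of \<open>K\<close>, and their
  quotient is the required power.\<close>

lemma finite_index_pow_mem:
  assumes K: "subgroup K G" "finite (rcosets K)" and x: "x \<in> carrier G"
  obtains n :: nat where "n > 0" "x [^] n \<in> K"
proof -
  interpret K: subgroup K G by fact
  have "range (\<lambda>i::nat. K #> x [^] i) \<subseteq> rcosets K"
    using x by (auto simp: RCOSETS_def)
  then have "\<not> inj (\<lambda>i::nat. K #> x [^] i)"
    using K(2) by (meson finite_imageD finite_subset infinite_UNIV_nat)
  then obtain i j :: nat where ij: "i < j" "K #> x [^] i = K #> x [^] j"
    by (metis (mono_tags, lifting) injI linorder_neqE_nat)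
  have "x [^] j \<otimes> inv (x [^] i) \<in> K"
    using rcos_self[OF _ K(1), of "x [^] j"] x K.rcos_module[OF is_group, of "x [^] i" "x [^] j"]
    by (simp add: ij(2))
  moreover have "x [^] j = x [^] (j - i) \<otimes> x [^] i"
    using ij(1) x by (simp add: nat_pow_mult)
  ultimately have "x [^] (j - i) \<in> K" using x by (simp add: m_assoc)
  with ij(1) show ?thesis by (intro that[of "j - i"]) auto
qed

text \<open>With \<open>d = conj_by t c\<close>, the commutator of \<open>t\<close> and
  \<open>c\<close> is \<open>d \<otimes> inv c\<close>. As \<open>d\<close> commutes with
  \<open>c\<close>, its square is \<open>d\<close> squared times the inverse of \<open>c\<close>
  squared; since this is trivial, the two squares agree.\<close>

lemma conj_by_square:
  assumes c: "c \<in> carrier G" and t: "t \<in> carrier G"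
    and comm: "c \<otimes> conj_by t c = conj_by t c \<otimes> c"
    and sq: "(t \<otimes> c \<otimes> inv t \<otimes> inv c) \<otimes> (t \<otimes> c \<otimes> inv t \<otimes> inv c) = \<one>"
  shows "conj_by t (c \<otimes> c) = c \<otimes> c"
proof -
  define d where "d = conj_by t c"
  have d: "d \<in> carrier G" using c t by (simp add: d_def)
  have "inv c \<otimes> d = d \<otimes> inv c"
    using int_pow_commute[of c d "-1" 1] c d comm by (simp add: d_def int_pow_neg)
  then have "d \<otimes> d \<otimes> inv c \<otimes> inv c = (d \<otimes> inv c) \<otimes> (d \<otimes> inv c)"
    using c d by (metis inv_closed m_assoc m_closed)
  also have "\<dots> = \<one>" using sq by (simp add: d_def conj_by_def)
  finally have "d \<otimes> d \<otimes> inv (c \<otimes> c) = \<one>" using c d by (simp add: inv_mult_group m_assoc)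
  then have "d \<otimes> d = c \<otimes> c" using c d by (metis inv_closed inv_equality inv_inv m_closed)
  then show ?thesis using c t by (simp add: conj_by_mult d_def)
qed

end

section \<open>Finitely generated abelian groups modulo squares\<close>

text \<open>Modulo squares only the parity of the exponent of each generator matters, so the
  products over subsets of \<open>S\<close> serve as \<open>T\<close>.\<close>

lemma (in comm_group) generate_finite_mod_squares:
  assumes S: "finite S" "S \<subseteq> carrier G"
  obtains T where "finite T" "T \<subseteq> carrier G"
    "\<And>x. x \<in> generate G S \<Longrightarrow> \<exists>u\<in>T. \<exists>v\<in>carrier G. x = u \<otimes> (v \<otimes> v)"
proof
  define p :: "'a set \<Rightarrow> 'a" where "p U = finprod G (\<lambda>x. x) U" for U
  have p: "p U \<in> carrier G" if "U \<subseteq> S" for U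
    using that S by (auto simp: p_def intro!: finprod_closed)
  show "finite (p ` Pow S)" using S by simp
  show "p ` Pow S \<subseteq> carrier G" using p by auto
  have p_split: "p U = p (U - V) \<otimes> p (U \<inter> V)" if "U \<subseteq> S" for U V
  proof -
    have "p ((U - V) \<union> (U \<inter> V)) = p (U - V) \<otimes> p (U \<inter> V)"
      unfolding p_def using that S
      by (intro finprod_Un_disjoint) (auto intro: finite_subset[OF _ S(1)])
    then show ?thesis by (simp add: Un_Diff_Int)
  qed
  show "\<exists>u\<in>p ` Pow S. \<exists>v\<in>carrier G. x = u \<otimes> (v \<otimes> v)" if "x \<in> generate G S" for x
    using that
  proof induction
    case one
    have "\<one> = p {} \<otimes> (\<one> \<otimes> \<one>)" by (simp add: p_def)
    then show ?case by blast
  next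
    case (incl h)
    then have "h = p {h} \<otimes> (\<one> \<otimes> \<one>)" using S by (auto simp: p_def)
    with incl show ?case by blast
  next
    case (inv h)
    then have "h \<in> carrier G" using S by auto
    then have "inv h = p {h} \<otimes> (inv h \<otimes> inv h)" by (simp add: p_def)
    with inv \<open>h \<in> carrier G\<close> show ?case by blast
  next
    case (eng x y)
    then obtain U V v w where U: "U \<subseteq> S" "v \<in> carrier G" "x = p U \<otimes> (v \<otimes> v)"
      and V: "V \<subseteq> S" "w \<in> carrier G" "y = p V \<otimes> (w \<otimes> w)" by auto
    \<comment> \<open>Generators in both \<open>U\<close> and \<open>V\<close> occur twice and move
      into the square; those in exactly one of the sets remain.\<close>
    let ?D = "(U - V) \<union> (V - U)" and ?z = "p (U \<inter> V) \<otimes> v \<otimes> w"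
    have D: "p ?D = p (U - V) \<otimes> p (V - U)"
      unfolding p_def using U V S
      by (intro finprod_Un_disjoint) (auto intro: finite_subset[OF _ S(1)])
    have c: "p (U - V) \<in> carrier G" "p (V - U) \<in> carrier G" "p (U \<inter> V) \<in> carrier G"
      using U V by (auto intro!: p)
    have "x \<otimes> y = p ?D \<otimes> (?z \<otimes> ?z)"
      unfolding D U(3) V(3) p_split[OF U(1), of V] p_split[OF V(1), of U] Int_commute[of V U]
      using U V c by (simp add: m_ac)
    moreover have "?z \<in> carrier G" "?D \<in> Pow S" using U V c by auto
    ultimately show ?case by blast
  qed
qed

section \<open>Conjugation mapping a subgroup into itself: abelian bases and LERF\<close>

context group
begin

text \<open>Conjugation by \<open>t\<close> fixes all squares of \<open>B\<close>, and
  \<open>B\<close> has finitely many classes modulo squares. So two iterates of \<open>b\<close>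
  differ by a square; undoing the common conjugations leaves \<open>b\<close> as a proper iterate of
  itself times a fixed square, which is an image.\<close>

lemma conj_by_fg_abelian_surj:
  assumes sq: "\<And>x y. \<lbrakk>x \<in> carrier G; y \<in> carrier G\<rbrakk> \<Longrightarrow>
      (x \<otimes> y \<otimes> inv x \<otimes> inv y) \<otimes> (x \<otimes> y \<otimes> inv x \<otimes> inv y) = \<one>"
    and B: "subgroup B G" "fg_subgroup B G" "comm_group (G\<lparr>carrier := B\<rparr>)"
    and t: "t \<in> carrier G" and sub: "conj_by t ` B \<subseteq> B"
  shows "conj_by t ` B = B"
proof
  show "B \<subseteq> conj_by t ` B"
  proof
    fix b assume b: "b \<in> B"
    interpret B: subgroup B G by fact
    interpret GB: comm_group "G\<lparr>carrier := B\<rparr>" by fact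
    have comm: "x \<otimes> y = y \<otimes> x" if "x \<in> B" "y \<in> B" for x y
      using GB.m_comm[of x y] that by simp
    obtain S where S: "finite S" "S \<subseteq> carrier G" "B = generate G S"
      using B(2) by (auto simp: fg_subgroup_def)
    have SB: "S \<subseteq> B" using S(3) by (auto intro: generate.incl)
    obtain T where T: "finite T" "T \<subseteq> B"
      "\<And>x. x \<in> B \<Longrightarrow> \<exists>u\<in>T. \<exists>v\<in>B. x = u \<otimes> (v \<otimes> v)"
      using GB.generate_finite_mod_squares[of S] S SB generate_consistent[OF SB B(1)] by auto
    \<comment> \<open>\<open>r x\<close> is a representative of \<open>x\<close> modulo squares, and
      the square of \<open>q x\<close> makes up the difference.\<close>
    then obtain r q where r: "\<And>x. x \<in> B \<Longrightarrow> r x \<in> T \<and> q x \<in> B \<and> x = r x \<otimes> (q x \<otimes> q x)"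
      by metis
    have it: "(conj_by t ^^ n) x \<in> B" if "x \<in> B" for n x
      using that sub by (induction n) auto
    have fix_sq: "(conj_by t ^^ n) (c \<otimes> c) = c \<otimes> c" if "c \<in> B" for n c
    proof (induction n)
      case (Suc n)
      moreover have "conj_by t (c \<otimes> c) = c \<otimes> c"
        using that sub t by (intro conj_by_square comm sq) auto
      ultimately show ?case by simp
    qed simp
    have "range (\<lambda>i. r ((conj_by t ^^ i) b)) \<subseteq> T" using r it b by auto
    then have "\<not> inj (\<lambda>i::nat. r ((conj_by t ^^ i) b))"
      using T(1) by (meson finite_imageD finite_subset infinite_UNIV_nat)
    then obtain i j :: nat where ij: "i < j" "r ((conj_by t ^^ i) b) = r ((conj_by t ^^ j) b)"
      by (metis (mono_tags, lifting) injI linorder_neqE_nat)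
    define v w where "v = q ((conj_by t ^^ i) b)" and "w = q ((conj_by t ^^ j) b)"
    define c where "c = v \<otimes> inv w"
    have vw: "v \<in> B" "w \<in> B" "c \<in> B" using r it b by (auto simp: v_def w_def c_def)
    have "(conj_by t ^^ i) b = r ((conj_by t ^^ i) b) \<otimes> (v \<otimes> v)"
      and j: "(conj_by t ^^ j) b = r ((conj_by t ^^ i) b) \<otimes> (w \<otimes> w)"
      using r[OF it[OF b, of i]] r[OF it[OF b, of j]] ij(2) by (simp_all add: v_def w_def)
    moreover have "v \<otimes> v = (w \<otimes> w) \<otimes> (c \<otimes> c)"
    proof -
      have "w \<otimes> c = v" using comm[of w c] vw by (simp add: c_def m_assoc)
      moreover have "(w \<otimes> w) \<otimes> (c \<otimes> c) = (w \<otimes> c) \<otimes> (w \<otimes> c)"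
        using vw comm[of w c] by (metis B.mem_carrier m_assoc m_closed)
      ultimately show ?thesis by simp
    qed
    moreover have "r ((conj_by t ^^ i) b) \<in> carrier G" using r[OF it[OF b, of i]] T(2) by auto
    ultimately have "(conj_by t ^^ i) b = (conj_by t ^^ j) b \<otimes> (c \<otimes> c)"
      using vw by (simp add: m_assoc)
    \<comment> \<open>The square is fixed, so it may be rewritten as its own conjugate; then
      conjugation by \<open>t [^] i\<close> stands outside on both sides and cancels.\<close>
    also have "\<dots> = conj_by (t [^] i) ((conj_by t ^^ (j - i)) b) \<otimes> conj_by (t [^] i) (c \<otimes> c)"
      using fix_sq[OF vw(3), of i] ij(1) it[OF b, of "j - i"] vw t
      by (simp add: conj_by_nat_pow flip: funpow_add[unfolded comp_def, THEN fun_cong])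
    also have "\<dots> = conj_by (t [^] i) ((conj_by t ^^ (j - i)) b \<otimes> (c \<otimes> c))"
      using t vw it[OF b, of "j - i"] by (simp add: conj_by_mult)
    finally have "conj_by (t [^] i) b = conj_by (t [^] i) ((conj_by t ^^ (j - i)) b \<otimes> (c \<otimes> c))"
      using t b by (simp add: conj_by_nat_pow)
    then have "b = (conj_by t ^^ (j - i)) b \<otimes> (c \<otimes> c)"
      using t b vw it[OF b, of "j - i"] by (subst (asm) conj_by_inj) auto
    \<comment> \<open>As \<open>i < j\<close>, at least one conjugation is left over; the fixed
      square is absorbed under it.\<close>
    also have "(conj_by t ^^ (j - i)) b = conj_by t ((conj_by t ^^ (j - i - 1)) b)"
      using ij(1) by (cases "j - i") auto
    also have "\<dots> \<otimes> (c \<otimes> c) = conj_by t ((conj_by t ^^ (j - i - 1)) b \<otimes> (c \<otimes> c))"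
      using t vw it[OF b, of "j - i - 1"] fix_sq[OF vw(3), of 1] by (simp add: conj_by_mult)
    finally show "b \<in> conj_by t ` B"
      using vw it[OF b, of "j - i - 1"] by blast
  qed
qed (use sub in auto)

text \<open>Pick \<open>b\<close> in \<open>B\<close> outside the image and let \<open>g\<close> be
  its preimage under the conjugation, so \<open>g\<close> is not in \<open>B\<close>. A finite-index
  \<open>K\<close> containing \<open>B\<close> but not \<open>g\<close> contains some
  \<open>t [^] n\<close> with \<open>n > 0\<close>. Conjugating \<open>g\<close> by that power gives
  an iterate of \<open>b\<close>, hence an element of \<open>B\<close> and of \<open>K\<close>;
  conjugating back inside \<open>K\<close> puts \<open>g\<close> into \<open>K\<close>.\<close>

lemma not_LERF_if_conj_by_psubset:
  assumes B: "fg_subgroup B G" and t: "t \<in> carrier G" and sub: "conj_by t ` B \<subset> B"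
  shows "\<not> LERF G"
proof
  assume "LERF G"
  with B have "\<exists>F. F \<noteq> {} \<and> (\<forall>K\<in>F. subgroup K G \<and> finite (rcosets K)) \<and> B = \<Inter>F"
    by (simp add: LERF_def)
  then obtain F where F: "F \<noteq> {}" "\<And>K. K \<in> F \<Longrightarrow> subgroup K G \<and> finite (rcosets K)" "B = \<Inter>F"
    by auto
  obtain S where S: "S \<subseteq> carrier G" "B = generate G S"
    using B by (auto simp: fg_subgroup_def)
  have BG: "x \<in> carrier G" if "x \<in> B" for x using that S generate_in_carrier by blast
  obtain b where b: "b \<in> B" "b \<notin> conj_by t ` B" using sub by auto
  define g where "g = conj_by (inv t) b"
  have g: "g \<in> carrier G" using b BG t by (simp add: g_def)
  have tg: "conj_by t g = b" using b BG t by (simp add: g_def conj_by_conj_by)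
  with b have "g \<notin> B" by auto
  then obtain K where K: "K \<in> F" "g \<notin> K" using F by auto
  then have sK: "subgroup K G" "finite (rcosets K)" using F by auto
  interpret K: subgroup K G by (rule sK)
  obtain n :: nat where n: "n > 0" "t [^] n \<in> K"
    using finite_index_pow_mem[OF sK t] .
  have "conj_by (t [^] n) g \<in> B"
  proof -
    have "(conj_by t ^^ n) g = (conj_by t ^^ (n - 1)) b"
      using n(1) tg by (cases n) (auto simp: funpow_swap1)
    moreover have "(conj_by t ^^ m) b \<in> B" for m
      using b sub by (induction m) auto
    ultimately show ?thesis using t g by (simp add: conj_by_nat_pow)
  qed
  then have "conj_by (t [^] n) g \<in> K" using F K by auto
  then have "conj_by (inv (t [^] n)) (conj_by (t [^] n) g) \<in> K"
    using n by (auto simp: conj_by_def[of "inv _"])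
  then show False using K(2) t g by (simp add: conj_by_conj_by)
qed

end

section \<open>Consequences of the relations of Baumslag's group\<close>

text \<open>Every quotient of Baumslag's group, even the trivial group, satisfies these assumptions.
  That the group is large enough therefore enters separately, as the hypothesis of
  \<open>not_LERF\<close>.\<close>

locale baumslag_relations = group G for G (structure) +
  fixes a s t
  assumes in_carrier [simp]: "a \<in> carrier G" "s \<in> carrier G" "t \<in> carrier G"
    and generates: "carrier G = generate G {a, s, t}"
    and a_square: "a \<otimes> a = \<one>"
    and s_t_commute: "s \<otimes> t = t \<otimes> s"
    and a_conj_commute: "a \<otimes> conj_by s a = conj_by s a \<otimes> a"
    and conj_t_a: "conj_by t a = a \<otimes> conj_by s a"
begin

text \<open>In the module picture this is the unit \<open>(1 + X)^j * X^i\<close>; conjugation adds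
  exponents.\<close>

definition c :: "int \<Rightarrow> int \<Rightarrow> 'a"
  where "c j i = conj_by (t [^] j \<otimes> s [^] i) a"

lemma c_closed [simp]: "c j i \<in> carrier G"
  by (simp add: c_def)

lemma c_0_0: "c 0 0 = a"
  by (simp add: c_def)

lemma conj_c: "conj_by (t [^] k \<otimes> s [^] l) (c j i) = c (k + j) (l + i)" for k l :: int
proof -
  have "s [^] l \<otimes> t [^] j = t [^] j \<otimes> s [^] l"
    using int_pow_commute[OF _ _ s_t_commute] by simp
  then have "t [^] k \<otimes> s [^] l \<otimes> (t [^] j \<otimes> s [^] i) = t [^] k \<otimes> t [^] j \<otimes> (s [^] l \<otimes> s [^] i)"
    by (metis in_carrier(2,3) int_pow_closed m_assoc m_closed)
  then show ?thesis
    by (simp add: c_def conj_by_conj_by int_pow_mult)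
qed

lemma conj_t_pow_c: "conj_by (t [^] k) (c j i) = c (k + j) i" for k :: int
  using conj_c[of k 0] by simp

lemma conj_s_pow_c: "conj_by (s [^] l) (c j i) = c j (l + i)" for l :: int
  using conj_c[of 0 l] by simp

text \<open>The relation for \<open>conj_by t a\<close>, conjugated; written additively,
  multiplication by \<open>1 + X\<close> is the sum of the identity and multiplication by
  \<open>X\<close>.\<close>

lemma c_Suc: "c (1 + j) i = c j i \<otimes> c j (1 + i)"
proof -
  have "c 1 0 = a \<otimes> c 0 1"
    using conj_t_a by (simp add: c_def)
  then have "conj_by (t [^] j \<otimes> s [^] i) (c 1 0) = conj_by (t [^] j \<otimes> s [^] i) (c 0 0 \<otimes> c 0 1)"
    by (simp add: c_0_0)
  then show ?thesis
    by (simp add: conj_by_mult conj_c add.commute)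
qed

text \<open>Simultaneous conjugation translates both index pairs, so commuting depends only on their
  difference and may be tested against \<open>a\<close>.\<close>

lemma c_commute_iff:
  "c j i \<otimes> c j' i' = c j' i' \<otimes> c j i \<longleftrightarrow> a \<otimes> c (j' - j) (i' - i) = c (j' - j) (i' - i) \<otimes> a"
  using conj_by_commute_iff[of "t [^] j \<otimes> s [^] i" "c 0 0" "c (j' - j) (i' - i)"]
  by (simp add: conj_c) (simp add: c_0_0)

text \<open>Conjugating \<open>[a, c 0 (n - 1)] = 1\<close> by \<open>t\<close> gives \<open>[a \<cdot> c 0 1, c 0 (n - 1) \<cdot> c 0 n] = 1\<close>, and all pairs
  of factors but \<open>a\<close>, \<open>c 0 n\<close> commute by induction.\<close>

lemma a_commute_c_0_nat: "a \<otimes> c 0 (int n) = c 0 (int n) \<otimes> a"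
proof (induction n rule: less_induct)
  case (less n)
  consider "n = 0" | "n = 1" | m where "n = Suc (Suc m)"
    by (metis One_nat_def not0_implies_Suc)
  then show ?case
  proof cases
    case 3
    let ?x = "c 0 1" and ?y = "c 0 (1 + int m)" and ?z = "c 0 (2 + int m)"
    have z: "?z = c 0 (int n)" using 3 by (simp add: add.commute)
    have ay: "a \<otimes> ?y = ?y \<otimes> a" using less[of "Suc m"] 3 by simp
    have xy: "?x \<otimes> ?y = ?y \<otimes> ?x" using less[of m] 3 by (subst c_commute_iff) simp
    have xz: "?x \<otimes> ?z = ?z \<otimes> ?x" using less[of "Suc m"] 3 by (subst c_commute_iff) simp
    have "c 1 0 \<otimes> c 1 (1 + int m) = c 1 (1 + int m) \<otimes> c 1 0"
      using ay by (subst c_commute_iff) simp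
    then have "(a \<otimes> ?x) \<otimes> (?y \<otimes> ?z) = (?y \<otimes> ?z) \<otimes> (a \<otimes> ?x)"
      using c_Suc[of 0 0] c_Suc[of 0 "1 + int m"] by (simp add: c_0_0)
    moreover have "(a \<otimes> ?x) \<otimes> (?y \<otimes> ?z) = ?y \<otimes> (a \<otimes> ?z) \<otimes> ?x"
    proof -
      have "(a \<otimes> ?x) \<otimes> (?y \<otimes> ?z) = a \<otimes> (?x \<otimes> ?y) \<otimes> ?z" by (simp add: m_assoc)
      also have "\<dots> = (a \<otimes> ?y) \<otimes> (?x \<otimes> ?z)" by (simp add: m_assoc xy)
      also have "\<dots> = ?y \<otimes> (a \<otimes> ?z) \<otimes> ?x" by (simp add: m_assoc ay xz)
      finally show ?thesis .
    qed
    moreover have "(?y \<otimes> ?z) \<otimes> (a \<otimes> ?x) = ?y \<otimes> (?z \<otimes> a) \<otimes> ?x" by (simp add: m_assoc)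
    ultimately have "?y \<otimes> (a \<otimes> ?z) \<otimes> ?x = ?y \<otimes> (?z \<otimes> a) \<otimes> ?x" by simp
    then show ?thesis unfolding z[symmetric] by simp
  qed (use a_conj_commute in \<open>simp_all add: c_0_0\<close>, simp add: c_def)
qed

text \<open>For negative \<open>i\<close>, exchanging the two elements and translating changes the
  sign of the index.\<close>

lemma a_commute_c_0: "a \<otimes> c 0 i = c 0 i \<otimes> a"
proof (cases "i \<ge> 0")
  case True
  then show ?thesis using a_commute_c_0_nat[of "nat i"] by simp
next
  case False
  then have "c 0 0 \<otimes> c 0 (- i) = c 0 (- i) \<otimes> c 0 0"
    using a_commute_c_0_nat[of "nat (- i)"] by (simp add: c_0_0)
  then show ?thesis
    using c_commute_iff[of 0 "- i" 0 0] by simp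
qed

text \<open>\<open>c_Suc\<close> factors each element into two of the level below, at indices
  \<open>i\<close> and \<open>1 + i\<close>; hence the induction with \<open>i\<close>
  arbitrary.\<close>

lemma a_commute_c_nat: "a \<otimes> c (int n) i = c (int n) i \<otimes> a"
proof (induction n arbitrary: i)
  case 0
  then show ?case using a_commute_c_0 by simp
next
  case (Suc n)
  let ?x = "c (int n) i" and ?y = "c (int n) (1 + i)"
  have "a \<otimes> (?x \<otimes> ?y) = (a \<otimes> ?x) \<otimes> ?y" by (simp add: m_assoc)
  also have "\<dots> = ?x \<otimes> (a \<otimes> ?y)" by (simp add: Suc m_assoc)
  also have "\<dots> = (?x \<otimes> ?y) \<otimes> a" by (simp add: Suc m_assoc)
  finally show ?case using c_Suc[of "int n" i] by simp
qed

text \<open>The pair is ordered so that the difference of levels is nonnegative, since the preceding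
  induction only climbs.\<close>

lemma c_commute: "c j i \<otimes> c j' i' = c j' i' \<otimes> c j i"
proof (cases "j \<le> j'")
  case True
  then show ?thesis
    using a_commute_c_nat[of "nat (j' - j)"] by (subst c_commute_iff) simp
next
  case False
  then have "c j' i' \<otimes> c j i = c j i \<otimes> c j' i'"
    using a_commute_c_nat[of "nat (j - j')"] by (subst c_commute_iff) simp
  then show ?thesis by simp
qed

lemma c_square: "c j i \<otimes> c j i = \<one>"
proof -
  have "c j i \<otimes> c j i = conj_by (t [^] j \<otimes> s [^] i) (a \<otimes> a)"
    by (simp add: c_def conj_by_mult)
  then show ?thesis by (simp add: a_square conj_by_def)
qed

text \<open>By \<open>conj_C\<close> this is the whole conjugacy class of \<open>a\<close>.\<close>

definition C :: "'a set"
  where "C = {c j i | j i. True}"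

lemma C_subset: "C \<subseteq> carrier G"
  by (auto simp: C_def)

lemma conj_generators_C:
  assumes "g \<in> {a, s, t}" "h \<in> C"
  shows "conj_by g h \<in> C" "conj_by (inv g) h \<in> C"
proof -
  obtain j i where h: "h = c j i" using assms by (auto simp: C_def)
  have "inv a = a" using a_square by (intro inv_equality) auto
  moreover have "conj_by a h = h"
    using c_commute[of 0 0] by (simp add: conj_by_eq_self_iff h c_0_0)
  ultimately show "conj_by g h \<in> C" "conj_by (inv g) h \<in> C"
    using assms(1) conj_t_pow_c[of 1 j i] conj_t_pow_c[of "-1" j i] conj_s_pow_c[of 1 j i]
      conj_s_pow_c[of "-1" j i] by (fastforce simp: h C_def int_pow_neg)+
qed

lemma conj_C:
  assumes "g \<in> carrier G" "h \<in> C"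
  shows "conj_by g h \<in> C"
proof -
  \<comment> \<open>The condition on \<open>inv g\<close> makes \<open>?M\<close> closed under
    inverses, so that it suffices to check the generators.\<close>
  let ?M = "{g \<in> carrier G. \<forall>h\<in>C. conj_by g h \<in> C \<and> conj_by (inv g) h \<in> C}"
  have hG: "h \<in> carrier G" if "h \<in> C" for h using that C_subset by auto
  have "subgroup ?M G"
  proof (rule subgroupI)
    show "?M \<noteq> {}" using hG by (auto intro!: exI[of _ \<one>])
  next
    fix x y assume "x \<in> ?M" "y \<in> ?M"
    then show "x \<otimes> y \<in> ?M" using hG by (auto simp: inv_mult_group simp flip: conj_by_conj_by)
  qed auto
  moreover have "{a, s, t} \<subseteq> ?M" using conj_generators_C by auto
  ultimately have "carrier G \<subseteq> ?M" unfolding generates by (intro generate_subgroup_incl)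
  then show ?thesis using assms by auto
qed

text \<open>The normal closure of \<open>a\<close>; it is an elementary abelian 2-group.\<close>

definition N :: "'a set"
  where "N = generate G C"

lemma N_normal: "N \<lhd> G"
  unfolding N_def using C_subset conj_C
  by (intro normal_generateI) (auto simp: conj_by_def)

lemma N_commute: "x \<in> N \<Longrightarrow> y \<in> N \<Longrightarrow> x \<otimes> y = y \<otimes> x"
  unfolding N_def by (rule generate_commute[OF C_subset]) (auto simp: C_def c_commute)

lemma N_square: "x \<in> N \<Longrightarrow> x \<otimes> x = \<one>"
  unfolding N_def by (rule generate_square_one[OF C_subset]) (auto simp: C_def c_commute c_square)

text \<open>Modulo \<open>N\<close> the generator \<open>a\<close> vanishes, and the remaining
  generators \<open>s\<close> and \<open>t\<close> commute.\<close>

lemma derived_subset_N: "derived G (carrier G) \<subseteq> N"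
proof (rule derived_subset_normal[OF N_normal generates])
  interpret N: normal N G by (rule N_normal)
  have aN: "conj_by g a \<in> N" if "g \<in> carrier G" for g
  proof -
    have "c 0 0 \<in> C" by (auto simp: C_def)
    then have "a \<in> C" by (simp add: c_0_0)
    with that show ?thesis unfolding N_def by (intro generate.incl conj_C)
  qed
  have absorb: "N #> (n \<otimes> g) = N #> g" if "n \<in> N" "g \<in> carrier G" for n g
    using that by (simp add: coset_mult_assoc[symmetric] N.subset coset_join2 N.is_subgroup)
  have l: "N #> (a \<otimes> g) = N #> g" if "g \<in> carrier G" for g
    using absorb[OF aN[of \<one>] that] by simp
  \<comment> \<open>An \<open>a\<close> on the right becomes \<open>conj_by g a\<close> on the left,
    which \<open>N\<close> also absorbs.\<close>
  have r: "N #> (g \<otimes> a) = N #> g" if "g \<in> carrier G" for g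
    using absorb[OF aN[of g], of g] that by (simp add: conj_by_def m_assoc)
  show "N #> (x \<otimes> y) = N #> (y \<otimes> x)" if "x \<in> {a, s, t}" "y \<in> {a, s, t}" for x y
    using that s_t_commute by (auto simp: l r)
qed simp

text \<open>Commutators lie in \<open>N\<close>, which has exponent two; this supplies the
  assumption of \<open>conj_by_fg_abelian_surj\<close>.\<close>

lemma commutator_square:
  assumes "x \<in> carrier G" "y \<in> carrier G"
  shows "(x \<otimes> y \<otimes> inv x \<otimes> inv y) \<otimes> (x \<otimes> y \<otimes> inv x \<otimes> inv y) = \<one>"
  using derived_subset_N assms unfolding derived_def
  by (intro N_square) (auto intro!: generate.incl)

lemma solvable: "solvable G"
proof -
  let ?D = "derived G (carrier G)"
  have D: "x \<otimes> y \<otimes> inv x \<otimes> inv y = \<one>" if "x \<in> ?D" "y \<in> ?D" for x y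
  proof -
    have "x \<in> carrier G" "y \<in> carrier G" using that derived_in_carrier[of "carrier G"] by auto
    moreover have "x \<otimes> y = y \<otimes> x" using that derived_subset_N by (intro N_commute) auto
    ultimately show ?thesis by (simp add: m_assoc)
  qed
  have "derived G ?D \<subseteq> {\<one>}"
    unfolding derived_def[of G ?D] using D
    by (intro generate_subgroup_incl triv_subgroup) auto
  moreover have "\<one> \<in> derived G ?D" by (simp add: derived_def generate.one)
  ultimately have "(derived G ^^ 2) (carrier G) = {\<one>}" by (auto simp: numeral_2_eq_2)
  then show ?thesis unfolding solvable_iff_trivial_derived_seq by blast
qed

lemma no_HNN:
  "\<not> (\<exists>H B t. strictly_ascending_HNN_in G H B t \<and>
      fg_subgroup B G \<and> comm_group (G\<lparr>carrier := B\<rparr>))"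
proof clarify
  fix H B u
  assume H: "strictly_ascending_HNN_in G H B u" and B: "fg_subgroup B G" "comm_group (G\<lparr>carrier := B\<rparr>)"
  then have sub: "subgroup H G" "subgroup B G" "u \<in> H" "conj_by u ` B \<subset> B"
    by (auto simp: strictly_ascending_HNN_in_def Let_def conj_by_def)
  then have "u \<in> carrier G" by (intro subgroup.mem_carrier)
  with sub B have "conj_by u ` B = B"
    by (intro conj_by_fg_abelian_surj commutator_square) auto
  with sub show False by auto
qed

text \<open>Conjugation by \<open>t\<close> fixes \<open>s\<close> and sends \<open>a\<close> to
  \<open>a \<otimes> conj_by s a\<close>, so it maps \<open>generate G {a, s}\<close> into itself.
  It misses \<open>a\<close>, whose only preimage is \<open>conj_by (inv t) a\<close>.\<close>

lemma not_LERF: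
  assumes "conj_by (inv t) a \<notin> generate G {a, s}"
  shows "\<not> LERF G"
proof (rule not_LERF_if_conj_by_psubset)
  let ?B = "generate G {a, s}"
  have ts: "conj_by t s = s"
    using s_t_commute by (simp add: conj_by_eq_self_iff)
  have B: "subgroup ?B G" by (intro generate_is_subgroup) simp
  interpret B: subgroup ?B G by fact
  have s: "a \<in> ?B" "s \<in> ?B" by (auto intro: generate.incl)
  interpret h: group_hom G G "conj_by t"
    by unfold_locales (auto simp: hom_def conj_by_mult)
  have "conj_by t ` ?B = generate G {conj_by t a, s}"
    using h.generate_img[of "{a, s}"] ts by simp
  also have "\<dots> \<subseteq> ?B"
  proof (intro generate_subgroup_incl B)
    have "conj_by t a \<in> ?B" using s unfolding conj_t_a by (simp add: conj_by_def)
    with s show "{conj_by t a, s} \<subseteq> ?B" by simp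
  qed
  finally have "conj_by t ` ?B \<subseteq> ?B" .
  moreover have "a \<notin> conj_by t ` ?B"
  proof
    assume "a \<in> conj_by t ` ?B"
    then obtain x where x: "a = conj_by t x" "x \<in> ?B" by auto
    then have "conj_by (inv t) a = x" by (simp add: conj_by_conj_by)
    with x assms show False by simp
  qed
  ultimately show "conj_by t ` ?B \<subset> ?B" using s by blast
  show "fg_subgroup ?B G" by (auto simp: fg_subgroup_def intro!: exI[of _ "{a, s}"])
qed simp

end

section \<open>Generators and universal property of free groups\<close>

definition free_gen :: "'x set \<Rightarrow> 'x \<Rightarrow> (bool \<times> 'x) list set"
  where "free_gen X x =
    word_class (UNIV \<times> X) {([(b, x), (\<not> b, x)], []) | b x. x \<in> X} [(True, x)]"

lemma free_gen_closed: "x \<in> X \<Longrightarrow> free_gen X x \<in> carrier (free_group X)"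
  by (auto simp: free_gen_def free_group_def word_monoid_simps)

lemma free_group_generated: "carrier (free_group X) = generate (free_group X) (free_gen X ` X)"
proof
  interpret F: group "free_group X" by (rule group_free_group)
  let ?A = "(UNIV :: bool set) \<times> X"
  let ?R = "{([(b, x), (\<not> b, x)], []) | b x. x \<in> X}"
  have letter: "word_class ?A ?R [(b, x)] \<in> generate (free_group X) (free_gen X ` X)"
    if x: "x \<in> X" for b x
  proof (cases b)
    case True
    with x show ?thesis by (auto simp: free_gen_def intro: generate.incl)
  next
    case False
    have "word_cong ?A ?R ([] @ [(False, x), (\<not> False, x)] @ []) ([] @ [] @ [])"
      using x by (intro word_cong.rule) auto
    then have "word_class ?A ?R [(False, x)] \<otimes>\<^bsub>free_group X\<^esub> free_gen X x = \<one>\<^bsub>free_group X\<^esub>"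
      using x by (simp add: free_gen_def free_group_def word_monoid_mult word_monoid_simps
          word_class_eq_iff)
    moreover have "word_class ?A ?R [(False, x)] \<in> carrier (free_group X)"
      using x by (auto simp: free_group_def word_monoid_simps)
    ultimately have "inv\<^bsub>free_group X\<^esub> free_gen X x = word_class ?A ?R [(False, x)]"
      using x by (intro F.inv_equality free_gen_closed)
    with x False show ?thesis using generate.inv[of "free_gen X x" "free_gen X ` X" "free_group X"] by simp
  qed
  have "word_class ?A ?R w \<in> generate (free_group X) (free_gen X ` X)" if "w \<in> lists ?A" for w
    using that
  proof (induction w)
    case Nil
    then show ?case
      using generate.one[of "free_group X"] by (simp add: free_group_def word_monoid_simps)
  next
    case (Cons l w)
    then have "word_class ?A ?R (l # w) =
        word_class ?A ?R [l] \<otimes>\<^bsub>free_group X\<^esub> word_class ?A ?R w"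
      by (subst free_group_def) (simp add: word_monoid_mult)
    with Cons show ?case using letter by (cases l) (auto intro!: generate.eng)
  qed
  then show "carrier (free_group X) \<subseteq> generate (free_group X) (free_gen X ` X)"
    by (auto simp: free_group_def word_monoid_simps)
  show "generate (free_group X) (free_gen X ` X) \<subseteq> carrier (free_group X)"
    by (intro F.generate_incl) (auto intro: free_gen_closed)
qed

text \<open>Words are evaluated letter by letter. Deleting an inverse pair does not change the
  value, so evaluation is constant on classes.\<close>

lemma (in group) free_group_lift:
  assumes f: "\<And>x. x \<in> X \<Longrightarrow> f x \<in> carrier G"
  obtains h where "h \<in> hom (free_group X) G" "\<And>x. x \<in> X \<Longrightarrow> h (free_gen X x) = f x"
proof
  let ?A = "(UNIV :: bool set) \<times> X"
  let ?R = "{([(b, x), (\<not> b, x)], []) | b x. x \<in> X}"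
  define ev where "ev = foldr (\<lambda>(b, x) g. (if b then f x else inv f x) \<otimes> g)"
  \<comment> \<open>The image of a class under evaluation is a singleton, whose element
    \<open>the_elem\<close> extracts.\<close>
  define h where "h C = the_elem ((\<lambda>w. ev w \<one>) ` C)" for C
  have closed: "ev w g \<in> carrier G" if "w \<in> lists ?A" "g \<in> carrier G" for w g
    using that by (induction w) (auto simp: ev_def f)
  have append: "ev (u @ v) \<one> = ev u \<one> \<otimes> ev v \<one>" if "u \<in> lists ?A" "v \<in> lists ?A" for u v
    using that
  proof (induction u)
    case Nil
    then show ?case using closed[of v \<one>] by (simp add: ev_def)
  next
    case (Cons l u)
    then show ?case using closed[of u \<one>] closed[of v \<one>] by (auto simp: ev_def f m_assoc)
  qed
  have cong: "ev u \<one> = ev v \<one>" if "word_cong ?A ?R u v" for u v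
    using that
  proof induction
    case (rule l r u v)
    then obtain b x where l: "l = [(b, x), (\<not> b, x)]" "r = []" "x \<in> X" by auto
    then have "ev l \<one> = \<one>" "ev r \<one> = \<one>" by (auto simp: ev_def f)
    with rule show ?case using closed[of _ \<one>] by (simp add: append)
  qed auto
  have h: "h (word_class ?A ?R w) = ev w \<one>" if "w \<in> lists ?A" for w
  proof -
    have "(\<lambda>w. ev w \<one>) ` word_class ?A ?R w = {ev w \<one>}"
      using that cong by (auto simp: word_class_def intro!: image_eqI[of _ _ w] word_cong.refl)
    then show ?thesis by (simp add: h_def)
  qed
  show "h \<in> hom (free_group X) G"
  proof (rule homI)
    show "h x \<in> carrier G" if x: "x \<in> carrier (free_group X)" for x
    proof -
      obtain w where "x = word_class ?A ?R w" "w \<in> lists ?A"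
        using x unfolding free_group_def word_monoid_simps by (rule imageE)
      then show ?thesis using closed[of w \<one>] by (simp add: h)
    qed
    show "h (x \<otimes>\<^bsub>free_group X\<^esub> y) = h x \<otimes> h y"
      if x: "x \<in> carrier (free_group X)" and y: "y \<in> carrier (free_group X)" for x y
    proof -
      obtain u where "x = word_class ?A ?R u" "u \<in> lists ?A"
        using x unfolding free_group_def word_monoid_simps by (rule imageE)
      moreover obtain v where "y = word_class ?A ?R v" "v \<in> lists ?A"
        using y unfolding free_group_def word_monoid_simps by (rule imageE)
      ultimately show ?thesis
        by (simp add: free_group_def word_monoid_mult h append)
    qed
  qed
  show "h (free_gen X x) = f x" if "x \<in> X" for x
    using that f by (simp add: free_gen_def h) (simp add: ev_def)
qed

section \<open>Normal closures and countable quotients carried by the natural numbers\<close>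

lemma (in group) normal_closure_incl: "R \<subseteq> normal_closure G R"
  by (auto simp: normal_closure_def)

lemma (in group) normal_closure_minimal:
  "\<lbrakk>N \<lhd> G; R \<subseteq> N\<rbrakk> \<Longrightarrow> normal_closure G R \<subseteq> N"
  by (auto simp: normal_closure_def)

lemma countable_free_group: "countable (carrier (free_group (X :: 'x :: countable set)))"
  by (simp add: free_group_def word_monoid_simps)

text \<open>Numbering the countably many cosets moves the quotient from sets of elements to the type
  \<open>nat\<close>: the numbering separates cosets, so its fibres are exactly those of the
  quotient map.\<close>

lemma (in group) weak_group_morphism_to_nat:
  assumes "countable (carrier G)" "N \<lhd> G"
  shows "weak_group_morphism (\<lambda>x. to_nat_on (rcosets N) (N #> x)) N G"
proof (rule weak_group_morphismsI)
  fix a b assume ab: "a \<in> carrier G" "b \<in> carrier G"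
  interpret N: normal N G by fact
  have "countable (rcosets N)"
    using assms(1) by (simp add: RCOSETS_def)
  then have "to_nat_on (rcosets N) (N #> a) = to_nat_on (rcosets N) (N #> b) \<longleftrightarrow> N #> a = N #> b"
    using ab by (intro to_nat_on_inj rcosetsI N.subset)
  also have "\<dots> \<longleftrightarrow> a \<in> N #> b"
    using ab rcos_self[OF _ N.is_subgroup] repr_independence[OF _ _ N.is_subgroup] by metis
  also have "\<dots> \<longleftrightarrow> a \<otimes> inv b \<in> N"
    by (rule N.rcos_module[OF is_group ab(2,1)])
  finally show "to_nat_on (rcosets N) (N #> a) = to_nat_on (rcosets N) (N #> b) \<longleftrightarrow> a \<otimes> inv b \<in> N" .
qed fact

section \<open>Affine bijections of the Laurent series over GF(2)\<close>

lemma BijGroup_UNIV_simps: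
  "carrier (BijGroup UNIV) = {f. bij f}"
  "\<one>\<^bsub>BijGroup UNIV\<^esub> = id"
  "\<lbrakk>bij g; bij f\<rbrakk> \<Longrightarrow> g \<otimes>\<^bsub>BijGroup UNIV\<^esub> f = g \<circ> f"
  by (auto simp: BijGroup_def Bij_def compose_def)

unbundle fps_syntax

definition laurent_poly :: "bit fls set"
  where "laurent_poly = {u. finite {n. u $$ n \<noteq> 0}}"

text \<open>Comparing coefficients, neighbouring ones agree except across 0. So they are constant
  from 0 upwards and from -1 downwards; finite support makes both constants 0, but the coefficients
  at 0 and -1 add up to 1.\<close>

lemma one_plus_X_inverse_not_laurent_poly:
  assumes "(1 + fls_X) * u = 1"
  shows "u \<notin> laurent_poly"
proof
  assume "u \<in> laurent_poly"
  then have fin: "finite {n. u $$ n \<noteq> 0}" by (simp add: laurent_poly_def)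
  have rec: "u $$ n + u $$ (n - 1) = (if n = 0 then 1 else 0)" for n
    using arg_cong[OF assms, of "\<lambda>v. v $$ n"]
    by (simp add: distrib_right fls_X_times_conv_shift)
  have pos: "u $$ (int n) = u $$ 0" for n
  proof (induction n)
    case (Suc n)
    then show ?case using rec[of "int (Suc n)"] by (cases "u $$ 0") auto
  qed simp
  have neg: "u $$ (- 1 - int n) = u $$ (- 1)" for n
  proof (induction n)
    case (Suc n)
    then show ?case using rec[of "- 1 - int n"] by (cases "u $$ (- 1)") (auto simp: algebra_simps)
  qed simp
  have "u $$ 0 = 0"
  proof (rule ccontr)
    assume "u $$ 0 \<noteq> 0"
    then have "range int \<subseteq> {n. u $$ n \<noteq> 0}" using pos by auto
    then show False using fin by (meson finite_imageD finite_subset infinite_UNIV_nat inj_of_nat)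
  qed
  moreover have "u $$ (- 1) = 0"
  proof (rule ccontr)
    assume "u $$ (- 1) \<noteq> 0"
    then have "range (\<lambda>n. - 1 - int n) \<subseteq> {n. u $$ n \<noteq> 0}" using neg by auto
    moreover have "inj (\<lambda>n. - 1 - int n)" by (rule injI) simp
    ultimately show False using fin by (meson finite_imageD finite_subset infinite_UNIV_nat)
  qed
  ultimately show False using rec[of 0] by simp
qed

lemma fls_bit_add_self [simp]: "u + u = 0" for u :: "bit fls"
  by (simp add: fls_eq_iff)

lemma fls_bit_add_one_twice: "u + 1 + 1 = u" for u :: "bit fls"
  unfolding add.assoc fls_bit_add_self by (rule add_0_right)

lemma bij_mult_left: "p \<noteq> 0 \<Longrightarrow> bij ((*) p)" for p :: "'a :: field"
  by (rule bij_betw_byWitness[where f' = "\<lambda>u. u / p"]) auto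

lemma bij_plus_one_bit_fls: "bij (\<lambda>u. u + 1 :: bit fls)"
  by (rule bij_betw_byWitness[where f' = "\<lambda>u. u + 1"]) (auto simp: fls_bit_add_one_twice)

text \<open>Equality rather than inclusion is stated so that the setwise stabilizer is a subgroup.
  The map is its own inverse.\<close>

lemma laurent_poly_plus_one: "(\<lambda>u. u + 1) ` laurent_poly = laurent_poly"
proof -
  have "u + 1 \<in> laurent_poly" if "u \<in> laurent_poly" for u
  proof -
    have "{n. (u + 1) $$ n \<noteq> 0} \<subseteq> insert 0 {n. u $$ n \<noteq> 0}" by auto
    moreover have "finite (insert 0 {n. u $$ n \<noteq> 0})" using that by (simp add: laurent_poly_def)
    ultimately have "finite {n. (u + 1) $$ n \<noteq> 0}" by (rule finite_subset)
    then show ?thesis unfolding laurent_poly_def by (rule CollectI)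
  qed
  moreover have "u \<in> (\<lambda>u. u + 1) ` laurent_poly" if "u + 1 \<in> laurent_poly" for u
    using fls_bit_add_one_twice[of u, symmetric] that by (rule image_eqI)
  ultimately show ?thesis by (intro equalityI subsetI) auto
qed

lemma laurent_poly_shift:
  assumes "u \<in> laurent_poly"
  shows "fls_shift k u \<in> laurent_poly"
proof -
  note assms
  moreover have "{n. fls_shift k u $$ n \<noteq> 0} \<subseteq> (\<lambda>n. n - k) ` {n. u $$ n \<noteq> 0}"
    by (auto intro!: image_eqI[of _ _ "_ + k"])
  ultimately have "finite {n. fls_shift k u $$ n \<noteq> 0}"
    unfolding laurent_poly_def mem_Collect_eq by (rule finite_surj)
  then show ?thesis unfolding laurent_poly_def by (rule CollectI)
qed

lemma laurent_poly_mult_X: "(*) fls_X ` laurent_poly = laurent_poly"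
proof -
  have "u = fls_X * fls_shift 1 u" for u :: "bit fls"
    by (simp add: fls_X_times_conv_shift)
  then have "u \<in> (*) fls_X ` laurent_poly" if "u \<in> laurent_poly" for u
    using that laurent_poly_shift by (intro image_eqI)
  then show ?thesis
    by (intro equalityI subsetI) (auto simp: fls_X_times_conv_shift laurent_poly_shift)
qed

lemma one_plus_X_nonzero: "1 + fls_X \<noteq> (0 :: bit fls)"
proof
  assume "1 + fls_X = (0 :: bit fls)"
  from arg_cong[OF this, of "\<lambda>u. u $$ 0"] show False by simp
qed


section \<open>The presented group and its affine action\<close>

text \<open>Translates between relators in a kernel and equations in the target.\<close>

lemma (in group_hom) mult_inv_in_kernel_iff:
  assumes xy: "x \<in> carrier G" "y \<in> carrier G"
  shows "x \<otimes> inv y \<in> kernel G H h \<longleftrightarrow> h x = h y"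
proof
  assume "x \<otimes> inv y \<in> kernel G H h"
  then have "h x \<otimes>\<^bsub>H\<^esub> inv\<^bsub>H\<^esub> h y = \<one>\<^bsub>H\<^esub>" using xy by (simp add: kernel_def)
  then have "inv\<^bsub>H\<^esub> (inv\<^bsub>H\<^esub> h y) = h x" using xy by (intro H.inv_equality) auto
  then show "h x = h y" using xy by simp
qed (use xy in \<open>simp add: kernel_def\<close>)

theorem theorem2p3:
  shows "\<exists>G :: nat monoid. group G \<and> finitely_presented G \<and> solvable G \<and> \<not> LERF G \<and>
    \<not> (\<exists>H B t. strictly_ascending_HNN_in G H B t \<and>
         fg_subgroup B G \<and> comm_group (G\<lparr>carrier := B\<rparr>))"
proof -
  define X where "X = {0, 1, 2 :: nat}"
  define F where "F = free_group X"
  interpret F: group F unfolding F_def by (rule group_free_group)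
  define \<alpha> \<sigma> \<tau> where "\<alpha> = free_gen X 0" and "\<sigma> = free_gen X 1" and "\<tau> = free_gen X 2"
  have gens [simp]: "\<alpha> \<in> carrier F" "\<sigma> \<in> carrier F" "\<tau> \<in> carrier F"
    by (auto simp: \<alpha>_def \<sigma>_def \<tau>_def F_def X_def intro!: free_gen_closed)
  have F_gen: "carrier F = generate F {\<alpha>, \<sigma>, \<tau>}"
    unfolding F_def by (subst free_group_generated) (simp add: X_def \<alpha>_def \<sigma>_def \<tau>_def)
  define \<beta> where "\<beta> = \<sigma> \<otimes>\<^bsub>F\<^esub> \<alpha> \<otimes>\<^bsub>F\<^esub> inv\<^bsub>F\<^esub> \<sigma>"
  have [simp]: "\<beta> \<in> carrier F" by (simp add: \<beta>_def)
  \<comment> \<open>The defining relations are kept as equations, since they are checked as such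
    both in \<open>G\<close> and in the affine action; \<open>R\<close> holds the matching
    relators.\<close>
  define E where "E = {(\<alpha> \<otimes>\<^bsub>F\<^esub> \<alpha>, \<one>\<^bsub>F\<^esub>), (\<sigma> \<otimes>\<^bsub>F\<^esub> \<tau>, \<tau> \<otimes>\<^bsub>F\<^esub> \<sigma>), (\<alpha> \<otimes>\<^bsub>F\<^esub> \<beta>, \<beta> \<otimes>\<^bsub>F\<^esub> \<alpha>),
    (\<tau> \<otimes>\<^bsub>F\<^esub> \<alpha> \<otimes>\<^bsub>F\<^esub> inv\<^bsub>F\<^esub> \<tau>, \<alpha> \<otimes>\<^bsub>F\<^esub> \<beta>)}"
  have E: "x \<in> carrier F \<and> y \<in> carrier F" if "(x, y) \<in> E" for x y
    using that by (auto simp: E_def)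
  define R where "R = (\<lambda>(x, y). x \<otimes>\<^bsub>F\<^esub> inv\<^bsub>F\<^esub> y) ` E"
  have R: "finite R" "R \<subseteq> carrier F" using E by (auto simp: R_def) (simp add: E_def)
  define K where "K = normal_closure F R"
  have K: "K \<lhd> F" unfolding K_def by (rule F.normal_closure_normal[OF R(2)])
  interpret K: normal K F by (rule K)
  define f :: "(bool \<times> nat) list set \<Rightarrow> nat"
    where "f = (\<lambda>x. to_nat_on (rcosets\<^bsub>F\<^esub> K) (K #>\<^bsub>F\<^esub> x))"
  have f: "weak_group_morphism f K F"
    unfolding f_def using K by (intro F.weak_group_morphism_to_nat) (simp_all add: F_def countable_free_group)
  define G where "G = image_group f F"
  interpret G: group G unfolding G_def by (rule F.image_group_is_group[OF f])
  interpret f: group_hom F G f unfolding G_def by (rule F.weak_group_morphism_group_hom[OF f])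
  have ker: "kernel F G f = K" unfolding G_def by (rule F.weak_group_morphism_ker[OF f])
  have rel: "f x = f y" if "(x, y) \<in> E" for x y
  proof -
    have "x \<otimes>\<^bsub>F\<^esub> inv\<^bsub>F\<^esub> y \<in> R" using that by (force simp: R_def)
    then have "x \<otimes>\<^bsub>F\<^esub> inv\<^bsub>F\<^esub> y \<in> kernel F G f" using F.normal_closure_incl ker by (auto simp: K_def)
    then show ?thesis using E[OF that] by (simp add: f.mult_inv_in_kernel_iff)
  qed
  have surj: "carrier G = f ` carrier F" by (simp add: G_def image_group_carrier)
  interpret B: baumslag_relations G "f \<alpha>" "f \<sigma>" "f \<tau>"
  proof
    show "carrier G = generate G {f \<alpha>, f \<sigma>, f \<tau>}"
      using f.generate_img[of "{\<alpha>, \<sigma>, \<tau>}"] by (simp add: surj flip: F_gen)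
    show "f \<alpha> \<otimes>\<^bsub>G\<^esub> f \<alpha> = \<one>\<^bsub>G\<^esub>" "f \<sigma> \<otimes>\<^bsub>G\<^esub> f \<tau> = f \<tau> \<otimes>\<^bsub>G\<^esub> f \<sigma>"
      "f \<alpha> \<otimes>\<^bsub>G\<^esub> G.conj_by (f \<sigma>) (f \<alpha>) = G.conj_by (f \<sigma>) (f \<alpha>) \<otimes>\<^bsub>G\<^esub> f \<alpha>"
      "G.conj_by (f \<tau>) (f \<alpha>) = f \<alpha> \<otimes>\<^bsub>G\<^esub> G.conj_by (f \<sigma>) (f \<alpha>)"
      using rel[of "\<alpha> \<otimes>\<^bsub>F\<^esub> \<alpha>" "\<one>\<^bsub>F\<^esub>"] rel[of "\<sigma> \<otimes>\<^bsub>F\<^esub> \<tau>" "\<tau> \<otimes>\<^bsub>F\<^esub> \<sigma>"]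
        rel[of "\<alpha> \<otimes>\<^bsub>F\<^esub> \<beta>" "\<beta> \<otimes>\<^bsub>F\<^esub> \<alpha>"] rel[of "\<tau> \<otimes>\<^bsub>F\<^esub> \<alpha> \<otimes>\<^bsub>F\<^esub> inv\<^bsub>F\<^esub> \<tau>" "\<alpha> \<otimes>\<^bsub>F\<^esub> \<beta>"]
      by (simp_all add: E_def G.conj_by_def \<beta>_def)
  qed simp_all
  have "\<not> LERF G"
  proof (rule B.not_LERF, rule notI)
    let ?P = "BijGroup (UNIV :: bit fls set)"
    interpret P: group ?P by (rule group_BijGroup)
    \<comment> \<open>The generators act as translation by 1 and as multiplication by
      \<open>X\<close> and by \<open>1 + X\<close>. The last case is meant for the generator
      2.\<close>
    define act :: "nat \<Rightarrow> bit fls \<Rightarrow> bit fls"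
      where "act x = (if x = 0 then \<lambda>u. u + 1 else if x = 1 then (*) fls_X else (*) (1 + fls_X))" for x
    have "act x \<in> carrier ?P" for x
      by (simp add: act_def BijGroup_UNIV_simps bij_plus_one_bit_fls bij_mult_left one_plus_X_nonzero)
    then obtain \<phi> where \<phi>: "\<phi> \<in> hom F ?P" "\<And>x. x \<in> X \<Longrightarrow> \<phi> (free_gen X x) = act x"
      unfolding F_def using P.free_group_lift[of X act] by blast
    interpret \<phi>: group_hom F ?P \<phi> using \<phi>(1) by unfold_locales
    have \<phi>_gens: "\<phi> \<alpha> = (\<lambda>u. u + 1)" "\<phi> \<sigma> = (*) fls_X" "\<phi> \<tau> = (*) (1 + fls_X)"
      using \<phi>(2)[of 0] \<phi>(2)[of 1] \<phi>(2)[of 2] by (simp_all add: X_def \<alpha>_def \<sigma>_def \<tau>_def act_def)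
    have bij: "bij (\<phi> w)" if "w \<in> carrier F" for w
      using \<phi>.hom_closed[OF that] by (simp add: BijGroup_UNIV_simps)
    have \<phi>_mult: "\<phi> (v \<otimes>\<^bsub>F\<^esub> w) = \<phi> v \<circ> \<phi> w" if "v \<in> carrier F" "w \<in> carrier F" for v w
      using that bij by (simp add: BijGroup_UNIV_simps)
    have \<phi>_cancel: "\<phi> w (\<phi> (inv\<^bsub>F\<^esub> w) u) = u" "\<phi> (inv\<^bsub>F\<^esub> w) (\<phi> w u) = u" if "w \<in> carrier F" for w u
      using \<phi>_mult[of w "inv\<^bsub>F\<^esub> w"] \<phi>_mult[of "inv\<^bsub>F\<^esub> w" w] that
      by (simp_all add: BijGroup_UNIV_simps fun_eq_iff)
    \<comment> \<open>A conjugate is identified through an intertwining equation, which avoids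
      computing the inverse of \<open>\<phi> v\<close>.\<close>
    have \<phi>_conj: "\<phi> (v \<otimes>\<^bsub>F\<^esub> w \<otimes>\<^bsub>F\<^esub> inv\<^bsub>F\<^esub> v) = g"
      if "v \<in> carrier F" "w \<in> carrier F" "\<phi> v \<circ> \<phi> w = g \<circ> \<phi> v" for v w g
    proof
      fix u
      show "\<phi> (v \<otimes>\<^bsub>F\<^esub> w \<otimes>\<^bsub>F\<^esub> inv\<^bsub>F\<^esub> v) u = g u"
        using fun_cong[OF that(3), of "\<phi> (inv\<^bsub>F\<^esub> v) u"] that(1,2)
        by (simp add: \<phi>_mult \<phi>_cancel del: \<phi>.hom_mult \<phi>.hom_inv)
    qed
    have \<phi>_\<beta>: "\<phi> \<beta> = (\<lambda>u. u + fls_X)"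
      unfolding \<beta>_def by (rule \<phi>_conj) (auto simp: \<phi>_gens algebra_simps)
    have "\<phi> (\<tau> \<otimes>\<^bsub>F\<^esub> \<alpha> \<otimes>\<^bsub>F\<^esub> inv\<^bsub>F\<^esub> \<tau>) = (\<lambda>u. u + (1 + fls_X))"
      by (rule \<phi>_conj) (auto simp: \<phi>_gens algebra_simps)
    then have "\<phi> x = \<phi> y" if "(x, y) \<in> E" for x y
      using that unfolding E_def
      by (auto simp: \<phi>_mult \<phi>_\<beta> \<phi>_gens fls_bit_add_one_twice fun_eq_iff BijGroup_UNIV_simps algebra_simps
          simp del: \<phi>.hom_mult)
    then have "R \<subseteq> kernel F ?P \<phi>" using E by (auto simp: R_def \<phi>.mult_inv_in_kernel_iff)
    then have K_ker: "K \<subseteq> kernel F ?P \<phi>"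
      unfolding K_def by (intro F.normal_closure_minimal \<phi>.normal_kernel)
    \<comment> \<open>The stabilizer is taken in \<open>F\<close> instead of \<open>G\<close>. It
      contains \<open>K\<close>, which acts trivially, so membership depends only on the image in
      \<open>G\<close>.\<close>
    define D where "D = {w \<in> carrier F. \<phi> w ` laurent_poly = laurent_poly}"
    have D: "subgroup D F"
    proof (rule F.subgroupI)
      show "inv\<^bsub>F\<^esub> w \<in> D" if "w \<in> D" for w
      proof -
        have w: "w \<in> carrier F" "\<phi> w ` laurent_poly = laurent_poly" using that by (auto simp: D_def)
        then have "\<phi> (inv\<^bsub>F\<^esub> w) ` laurent_poly = \<phi> (inv\<^bsub>F\<^esub> w) ` \<phi> w ` laurent_poly" by simp
        also have "\<dots> = laurent_poly" using w(1) by (simp add: image_image \<phi>_cancel del: \<phi>.hom_inv)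
        finally show ?thesis using w(1) unfolding D_def by (intro CollectI conjI) auto
      qed
      show "v \<otimes>\<^bsub>F\<^esub> w \<in> D" if "v \<in> D" "w \<in> D" for v w
        using that by (simp add: D_def \<phi>_mult image_comp[symmetric] del: \<phi>.hom_mult image_comp
              comp_apply)
      show "D \<noteq> {}" by (auto simp: D_def BijGroup_UNIV_simps intro!: exI[of _ "\<one>\<^bsub>F\<^esub>"])
    qed (auto simp: D_def)
    interpret D: subgroup D F by (rule D)
    have K_D: "K \<subseteq> D"
    proof
      fix w assume "w \<in> K"
      with K_ker have "w \<in> kernel F ?P \<phi>" by (rule subsetD)
      then have "w \<in> carrier F" "\<phi> w = id" by (simp_all add: kernel_def BijGroup_UNIV_simps)
      then show "w \<in> D" unfolding D_def by simp
    qed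
    have "{\<alpha>, \<sigma>} \<subseteq> D"
      unfolding D_def by (simp add: \<phi>_gens laurent_poly_plus_one laurent_poly_mult_X)
    then have gen_D: "generate F {\<alpha>, \<sigma>} \<subseteq> D" by (intro F.generate_subgroup_incl D)
    let ?w = "inv\<^bsub>F\<^esub> \<tau> \<otimes>\<^bsub>F\<^esub> \<alpha> \<otimes>\<^bsub>F\<^esub> \<tau>"
    assume "G.conj_by (inv\<^bsub>G\<^esub> f \<tau>) (f \<alpha>) \<in> generate G {f \<alpha>, f \<sigma>}"
    then have "f ?w \<in> f ` generate F {\<alpha>, \<sigma>}"
      using f.generate_img[of "{\<alpha>, \<sigma>}"] by (simp add: G.conj_by_def)
    then obtain g where g: "f ?w = f g" "g \<in> generate F {\<alpha>, \<sigma>}" by auto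
    then have gF: "g \<in> carrier F" using F.generate_in_carrier[of "{\<alpha>, \<sigma>}"] by simp
    \<comment> \<open>The words \<open>?w\<close> and \<open>g\<close> differ by an element of
      \<open>K\<close>, and both \<open>K\<close> and \<open>g\<close> lie in \<open>D\<close>;
      hence so does \<open>?w\<close>.\<close>
    then have "?w \<otimes>\<^bsub>F\<^esub> inv\<^bsub>F\<^esub> g \<in> K"
      using f.mult_inv_in_kernel_iff[of ?w g] g(1) unfolding ker by simp
    then have "(?w \<otimes>\<^bsub>F\<^esub> inv\<^bsub>F\<^esub> g) \<otimes>\<^bsub>F\<^esub> g \<in> D" by (rule D.m_closed[OF subsetD[OF K_D] subsetD[OF gen_D g(2)]])
    then have "?w \<in> D" using gF by (simp add: F.m_assoc)
    moreover have "0 \<in> laurent_poly" by (simp add: laurent_poly_def)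
    ultimately have "\<phi> ?w 0 \<in> laurent_poly" unfolding D_def by blast
    \<comment> \<open>\<open>\<tau>\<close> fixes 0 and \<open>\<alpha>\<close> moves it to 1, so
      \<open>?w\<close> sends 0 to the preimage of 1 under multiplication by
      \<open>1 + X\<close>.\<close>
    moreover have "(1 + fls_X) * \<phi> ?w 0 = 1"
      using \<phi>_cancel(1)[of \<tau> 1] by (simp add: \<phi>_mult \<phi>_gens del: \<phi>.hom_mult)
    ultimately show False using one_plus_X_inverse_not_laurent_poly by blast
  qed
  moreover have "finitely_presented G"
    unfolding finitely_presented_def
  proof (intro exI conjI)
    show "free_group X Mod normal_closure (free_group X) R \<cong> G"
      using F.weak_group_morphism_is_iso[OF f] unfolding G_def K_def F_def is_iso_def by blast
  qed (use R in \<open>simp_all add: X_def F_def\<close>)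
  ultimately show ?thesis
    using G.group_axioms B.solvable B.no_HNN by blast
qed

end
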